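(* Let $Q\in\mathbb{S}^n$, $c\in\mathbb{R}^n$, $A\in\mathbb{R}^{m\times n}$ of full row rank, $b\in\mathbb{R}^m$, $B\in\mathbb{R}^{l\times n}$, $d\in\mathbb{R}^l$, and let $k$ be an integer with $0<k<n$. Assume that the mixed-binary problem (MIQP) of the context is feasible and has optimal value $v^{\mathrm{P}}>-\infty$, and let $v^{\mathrm{UB}}\in\mathbb{R}$ be any upper bound on $v^{\mathrm{P}}$. Let $(\alpha,\Gamma,\Lambda,W,S)$ be feasible for the dual problem (D) of the context, with objective value $v^{\mathrm{LB}}=\alpha$. For $i\in\{1,\dots,n\}$ let $w_i:=(W_{12})_i^2/(W_{22})_{ii}$ if $(W_{22})_{ii}>0$ and $w_i:=0$ otherwise, and let $w_{[i]}$ denote the $i$-th largest value among $w_1,\dots,w_n$ (counted with multiplicity). Then for any $p\in\{1,\dots,n\}$, any optimal solution $(x^*,z^* )$ of (MIQP) satisfies $$z_p^*=\begin{cases}0,&\text{if } w_{[k]}-w_p>v^{\mathrm{UB}}-v^{\mathrm{LB}}, \\ 1,&\text{if } w_p-w_{[k+1]}>v^{\mathrm{UB}}-v^{\mathrm{LB}}.\end{cases}$$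
   Context: $\mathbb{S}^n$ is the space of real symmetric $n\times n$ matrices, $\mathbb{S}^n_+$ its positive semidefinite cone, $\langle U,V\rangle=\mathrm{Tr}(UV^\top)$, $e$ the all-ones vector, $\circ$ the entrywise product, $E_{11}\in\mathbb{S}^{n+1}$ the matrix with $1$ in the $(1,1)$ entry and $0$ elsewhere. Matrices in $\mathbb{S}^{n+1}$ are partitioned as $W=\begin{bmatrix}W_{11}&W_{12} \\ W_{21}&W_{22}\end{bmatrix}$ with $W_{11}\in\mathbb{R}$, $W_{12}=W_{21}^\top\in\mathbb{R}^{1\times n}$, $W_{22}\in\mathbb{S}^n$. For a square matrix $M$, $\operatorname{Diag}(M)$ is the diagonal matrix with the same diagonal as $M$. (MIQP): $\min_{x,z}\{x^\top Qx+2c^\top x:\ Ax=b,\ Bx\ge d,\ x\circ(e-z)=0,\ e^\top z\le k,\ z\in\{0,1\}^n\}$. Let $\overline{Q}=\begin{bmatrix}0&c^\top \\ c&Q\end{bmatrix}$ and, for $Y\in\mathbb{S}^{n+1}$, $$\mathcal{A}(Y)=\begin{bmatrix}-b&A\end{bmatrix}Y\begin{bmatrix}-b^\top \\ A^\top\end{bmatrix},\quad \mathcal{B}(Y)=\begin{bmatrix}1&0 \\ -d&B\end{bmatrix}Y\begin{bmatrix}1&0 \\ -d&B\end{bmatrix}^\top,\quad \mathcal{D}(Y)=\begin{bmatrix}kY_{11}&Y_{12} \\ Y_{21}&\operatorname{Diag}(Y_{22})\end{bmatrix}.$$ $\mathcal{A}^*,\mathcal{B}^*,\mathcal{D}^*$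 are the adjoints, with values in $\mathbb{S}^{n+1}$, of these linear maps with respect to $\langle\cdot,\cdot\rangle$ (e.g. $\langle\mathcal{B}(Y),\Lambda\rangle=\langle Y,\mathcal{B}^*(\Lambda)\rangle$ for all $Y\in\mathbb{S}^{n+1}$). (D): maximize $\alpha$ subject to $$\overline{Q}-\mathcal{A}^*(\Gamma)-\mathcal{B}^*(\Lambda)-\mathcal{D}^*(W)-S-\alpha E_{11}=0,$$ $\alpha\in\mathbb{R}$, $\Gamma\in\mathbb{S}^m$, $\Lambda\in\mathbb{R}^{(l+1)\times(l+1)}$ entrywise nonnegative, $W\in\mathbb{S}^{n+1}_+$, $S\in\mathbb{S}^{n+1}_+$. (D) is the dual of the relaxation $\min\{\langle\overline{Q},Y\rangle:\mathcal{A}(Y)=0,\ \mathcal{B}(Y)\ge0,\ Y_{11}=1,\ \mathcal{D}(Y)\succeq0,\ Y\succeq0\}$ of (MIQP). *)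

theory Defs
  imports "Jordan_Normal_Form.DL_Rank" "HOL-Library.Extended_Real"
begin

(* Matrices and vectors are indexed from 0, so an (n+1) x (n+1) matrix has its
   distinguished first row and column at index 0. *)

definition sym_mats :: "nat \<Rightarrow> real mat set" where
  "sym_mats N = {M \<in> carrier_mat N N. M\<^sup>T = M}"

definition psd_mats :: "nat \<Rightarrow> real mat set" where
  "psd_mats N = {M \<in> sym_mats N. \<forall>v \<in> carrier_vec N. 0 \<le> v \<bullet> (M *\<^sub>v v)}"

definition nonneg_mats :: "nat \<Rightarrow> real mat set" where
  "nonneg_mats N = {M \<in> carrier_mat N N. \<forall>i < N. \<forall>j < N. 0 \<le> M $$ (i, j)}"

definition mat_trace :: "real mat \<Rightarrow> real" where
  "mat_trace M = sum_list (diag_mat M)"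

definition mat_inner :: "real mat \<Rightarrow> real mat \<Rightarrow> real" where
  "mat_inner U V = mat_trace (U * V\<^sup>T)"

definition Diag :: "real mat \<Rightarrow> real mat" where
  "Diag M = mat_diag (dim_row M) (\<lambda>i. M $$ (i, i))"

definition E11 :: "nat \<Rightarrow> real mat" where
  "E11 N = mat N N (\<lambda>(i, j). if i = 0 \<and> j = 0 then 1 else 0)"

(* The adjoint of a linear map F defined on the symmetric N x N matrices, taking values
   there too.  It is pinned down by testing against symmetric Y only; for a non-symmetric Z
   it is therefore the symmetric part of the adjoint on all N x N matrices. *)
definition sym_adjoint :: "nat \<Rightarrow> (real mat \<Rightarrow> real mat) \<Rightarrow> real mat \<Rightarrow> real mat" where
  "sym_adjoint N F Z =
     (THE M. M \<in> sym_mats N \<and> (\<forall>Y \<in> sym_mats N. mat_inner (F Y) Z = mat_inner Y M))"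

definition ones_vec :: "nat \<Rightarrow> real vec" where
  "ones_vec n = vec n (\<lambda>_. 1)"

definition entrywise_prod :: "real vec \<Rightarrow> real vec \<Rightarrow> real vec" where
  "entrywise_prod u v = vec (dim_vec u) (\<lambda>i. u $ i * v $ i)"

definition miqp_objective :: "real mat \<Rightarrow> real vec \<Rightarrow> real vec \<Rightarrow> real" where
  "miqp_objective Q c x = x \<bullet> (Q *\<^sub>v x) + 2 * (c \<bullet> x)"

definition miqp_feasible ::
  "nat \<Rightarrow> nat \<Rightarrow> real mat \<Rightarrow> real vec \<Rightarrow> real mat \<Rightarrow> real vec \<Rightarrow> (real vec \<times> real vec) set" where
  "miqp_feasible n k A b B d =
     {(x, z). x \<in> carrier_vec n \<and> z \<in> carrier_vec n \<and>
        A *\<^sub>v x = b \<and> d \<le> B *\<^sub>v x \<and>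
        entrywise_prod x (ones_vec n - z) = 0\<^sub>v n \<and>
        ones_vec n \<bullet> z \<le> real k \<and>
        (\<forall>i < n. z $ i \<in> {0, 1})}"

definition miqp_value ::
  "nat \<Rightarrow> nat \<Rightarrow> real mat \<Rightarrow> real vec \<Rightarrow> real mat \<Rightarrow> real vec \<Rightarrow> real mat \<Rightarrow> real vec \<Rightarrow> ereal" where
  "miqp_value n k Q c A b B d =
     (INF (x, z) \<in> miqp_feasible n k A b B d. ereal (miqp_objective Q c x))"

definition miqp_optimal ::
  "nat \<Rightarrow> nat \<Rightarrow> real mat \<Rightarrow> real vec \<Rightarrow> real mat \<Rightarrow> real vec \<Rightarrow> real mat \<Rightarrow> real vec
     \<Rightarrow> (real vec \<times> real vec) set" where
  "miqp_optimal n k Q c A b B d =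
     {(x, z) \<in> miqp_feasible n k A b B d.
        \<forall>(x', z') \<in> miqp_feasible n k A b B d. miqp_objective Q c x \<le> miqp_objective Q c x'}"

definition Qbar :: "nat \<Rightarrow> real mat \<Rightarrow> real vec \<Rightarrow> real mat" where
  "Qbar n Q c = four_block_mat (0\<^sub>m 1 1) (mat_of_rows n [c]) (mat_of_cols n [c]) Q"

(* The m x (n+1) matrix [-b A]; the two lower blocks are empty. *)
definition A_ext :: "nat \<Rightarrow> nat \<Rightarrow> real mat \<Rightarrow> real vec \<Rightarrow> real mat" where
  "A_ext n m A b = four_block_mat (mat_of_cols m [- b]) A (0\<^sub>m 0 1) (0\<^sub>m 0 n)"

definition B_ext :: "nat \<Rightarrow> nat \<Rightarrow> real mat \<Rightarrow> real vec \<Rightarrow> real mat" where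
  "B_ext n l B d = four_block_mat (1\<^sub>m 1) (0\<^sub>m 1 n) (mat_of_cols l [- d]) B"

definition A_map :: "nat \<Rightarrow> nat \<Rightarrow> real mat \<Rightarrow> real vec \<Rightarrow> real mat \<Rightarrow> real mat" where
  "A_map n m A b Y = A_ext n m A b * Y * (A_ext n m A b)\<^sup>T"

definition B_map :: "nat \<Rightarrow> nat \<Rightarrow> real mat \<Rightarrow> real vec \<Rightarrow> real mat \<Rightarrow> real mat" where
  "B_map n l B d Y = B_ext n l B d * Y * (B_ext n l B d)\<^sup>T"

definition D_map :: "nat \<Rightarrow> real mat \<Rightarrow> real mat" where
  "D_map k Y = (case split_block Y 1 1 of (Y11, Y12, Y21, Y22) \<Rightarrow>
     four_block_mat (real k \<cdot>\<^sub>m Y11) Y12 Y21 (Diag Y22))"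

definition A_adj :: "nat \<Rightarrow> nat \<Rightarrow> real mat \<Rightarrow> real vec \<Rightarrow> real mat \<Rightarrow> real mat" where
  "A_adj n m A b = sym_adjoint (n + 1) (A_map n m A b)"

definition B_adj :: "nat \<Rightarrow> nat \<Rightarrow> real mat \<Rightarrow> real vec \<Rightarrow> real mat \<Rightarrow> real mat" where
  "B_adj n l B d = sym_adjoint (n + 1) (B_map n l B d)"

definition D_adj :: "nat \<Rightarrow> nat \<Rightarrow> real mat \<Rightarrow> real mat" where
  "D_adj n k = sym_adjoint (n + 1) (D_map k)"

definition dual_feasible ::
  "nat \<Rightarrow> nat \<Rightarrow> nat \<Rightarrow> nat \<Rightarrow> real mat \<Rightarrow> real vec \<Rightarrow> real mat \<Rightarrow> real vec \<Rightarrow> real mat \<Rightarrow> real vec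
     \<Rightarrow> (real \<times> real mat \<times> real mat \<times> real mat \<times> real mat) set" where
  "dual_feasible n m l k Q c A b B d =
     {(\<alpha>, \<Gamma>, \<Lambda>, W, S).
        \<Gamma> \<in> sym_mats m \<and> \<Lambda> \<in> nonneg_mats (l + 1) \<and>
        W \<in> psd_mats (n + 1) \<and> S \<in> psd_mats (n + 1) \<and>
        Qbar n Q c - A_adj n m A b \<Gamma> - B_adj n l B d \<Lambda> - D_adj n k W - S - \<alpha> \<cdot>\<^sub>m E11 (n + 1)
          = 0\<^sub>m (n + 1) (n + 1)}"

definition score_vec :: "nat \<Rightarrow> real mat \<Rightarrow> real vec" where
  "score_vec n W = (case split_block W 1 1 of (W11, W12, W21, W22) \<Rightarrow>
     vec n (\<lambda>i. if W22 $$ (i, i) > 0 then (W12 $$ (0, i))\<^sup>2 / W22 $$ (i, i) else 0))"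

(* The i-th largest entry with multiplicity, counted from i = 1. *)
definition nth_largest :: "real vec \<Rightarrow> nat \<Rightarrow> real" where
  "nth_largest w i = rev (sort (list_of_vec w)) ! (i - 1)"

lemma mat_inner_sum:
  assumes "U \<in> carrier_mat N K" "V \<in> carrier_mat N K"
  shows "mat_inner U V = (\<Sum>i<N. \<Sum>j<K. U $$ (i, j) * V $$ (i, j))"
proof -
  have "mat_inner U V = (\<Sum>i<N. (U * V\<^sup>T) $$ (i, i))"
    using assms unfolding mat_inner_def mat_trace_def diag_mat_def
    by (simp add: interv_sum_list_conv_sum_set_nat lessThan_atLeast0)
  also have "\<dots> = (\<Sum>i<N. \<Sum>j<K. U $$ (i, j) * V $$ (i, j))"
    using assms by (intro sum.cong) (auto simp: scalar_prod_def lessThan_atLeast0)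
  finally show ?thesis .
qed

lemma sym_adjoint_eqI:
  assumes M: "M \<in> sym_mats N"
    and adj: "\<And>Y. Y \<in> sym_mats N \<Longrightarrow> mat_inner (F Y) Z = mat_inner Y M"
  shows "sym_adjoint N F Z = M"
  unfolding sym_adjoint_def
proof (rule the_equality)
  show "M \<in> sym_mats N \<and> (\<forall>Y \<in> sym_mats N. mat_inner (F Y) Z = mat_inner Y M)"
    using assms by blast
next
  fix M' assume M': "M' \<in> sym_mats N \<and> (\<forall>Y \<in> sym_mats N. mat_inner (F Y) Z = mat_inner Y M')"
  have c: "M \<in> carrier_mat N N" "M' \<in> carrier_mat N N"
    using M M' by (auto simp: sym_mats_def)
  have tr: "M\<^sup>T = M" "M'\<^sup>T = M'"
    using M M' by (auto simp: sym_mats_def)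
  define Y where "Y = M - M'"
  have Y: "Y \<in> sym_mats N"
    using c tr unfolding Y_def sym_mats_def by (auto simp: transpose_minus)
  have Yc: "Y \<in> carrier_mat N N" using Y by (auto simp: sym_mats_def)
  have "mat_inner Y M = mat_inner Y M'"
    using adj[OF Y] M' Y by simp
  then have "(\<Sum>i<N. \<Sum>j<N. Y $$ (i, j) * M $$ (i, j) - Y $$ (i, j) * M' $$ (i, j)) = 0"
    by (simp add: mat_inner_sum[OF Yc c(1)] mat_inner_sum[OF Yc c(2)] sum_subtractf)
  moreover have "(\<Sum>i<N. \<Sum>j<N. Y $$ (i, j) * M $$ (i, j) - Y $$ (i, j) * M' $$ (i, j))
      = (\<Sum>i<N. \<Sum>j<N. (M $$ (i, j) - M' $$ (i, j))\<^sup>2)"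
    using c by (intro sum.cong refl) (simp add: Y_def power2_eq_square algebra_simps)
  ultimately have z: "(\<Sum>i<N. \<Sum>j<N. (M $$ (i, j) - M' $$ (i, j))\<^sup>2) = 0" by simp
  have "\<forall>i<N. \<forall>j<N. M $$ (i, j) = M' $$ (i, j)"
    using z by (auto simp: sum_nonneg_eq_0_iff sum_nonneg)
  then show "M' = M"
    using c by (intro eq_matI) auto
qed

lemma mat_inner_congruence:
  assumes C: "C \<in> carrier_mat K N" and Y: "Y \<in> carrier_mat N N" and Z: "Z \<in> carrier_mat K K"
  shows "mat_inner (C * Y * C\<^sup>T) Z = mat_inner Y (C\<^sup>T * Z * C)"
proof -
  have e1: "(C * Y * C\<^sup>T) $$ (i, j) = (\<Sum>q<N. \<Sum>p<N. C $$ (i, p) * Y $$ (p, q) * C $$ (j, q))"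
    if "i < K" "j < K" for i j
    using that C Y
    by (subst sum.swap) (simp add: scalar_prod_def lessThan_atLeast0 sum_distrib_left mult_ac)
  have e2: "(C\<^sup>T * Z * C) $$ (p, q) = (\<Sum>j<K. \<Sum>i<K. C $$ (i, p) * Z $$ (i, j) * C $$ (j, q))"
    if "p < N" "q < N" for p q
    using that C Z
    by (subst sum.swap) (simp add: scalar_prod_def lessThan_atLeast0 sum_distrib_left mult_ac)
  have c1: "C * Y * C\<^sup>T \<in> carrier_mat K K" "C\<^sup>T * Z * C \<in> carrier_mat N N"
    using C Y Z by auto
  have "mat_inner (C * Y * C\<^sup>T) Z
      = (\<Sum>i<K. \<Sum>j<K. \<Sum>q<N. \<Sum>p<N. C $$ (i, p) * Y $$ (p, q) * C $$ (j, q) * Z $$ (i, j))"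
    unfolding mat_inner_sum[OF c1(1) Z]
    by (intro sum.cong refl) (simp add: e1 sum_distrib_right)
  also have "\<dots> = (\<Sum>j<K. \<Sum>i<K. \<Sum>q<N. \<Sum>p<N. C $$ (i, p) * Y $$ (p, q) * C $$ (j, q) * Z $$ (i, j))"
    by (rule sum.swap)
  also have "\<dots> = (\<Sum>(j, i) \<in> {..<K} \<times> {..<K}. \<Sum>(q, p) \<in> {..<N} \<times> {..<N}.
      C $$ (i, p) * Y $$ (p, q) * C $$ (j, q) * Z $$ (i, j))"
    by (simp add: sum.cartesian_product[symmetric])
  also have "\<dots> = (\<Sum>(q, p) \<in> {..<N} \<times> {..<N}. \<Sum>(j, i) \<in> {..<K} \<times> {..<K}.
      C $$ (i, p) * Y $$ (p, q) * C $$ (j, q) * Z $$ (i, j))"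
    unfolding split_def by (rule sum.swap)
  also have "\<dots> = (\<Sum>q<N. \<Sum>p<N. \<Sum>j<K. \<Sum>i<K.
      C $$ (i, p) * Y $$ (p, q) * C $$ (j, q) * Z $$ (i, j))"
    by (simp add: sum.cartesian_product[symmetric])
  also have "\<dots> = (\<Sum>p<N. \<Sum>q<N. \<Sum>j<K. \<Sum>i<K.
      C $$ (i, p) * Y $$ (p, q) * C $$ (j, q) * Z $$ (i, j))"
    by (rule sum.swap)
  also have "\<dots> = mat_inner Y (C\<^sup>T * Z * C)"
    unfolding mat_inner_sum[OF Y c1(2)]
    by (intro sum.cong refl) (simp add: e2 sum_distrib_left mult_ac)
  finally show ?thesis .
qed

lemma sym_adjoint_congruence:
  assumes C: "C \<in> carrier_mat K N" and Z: "Z \<in> carrier_mat K K"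
  shows "sym_adjoint N (\<lambda>Y. C * Y * C\<^sup>T) Z = (1 / 2) \<cdot>\<^sub>m (C\<^sup>T * Z * C + (C\<^sup>T * Z * C)\<^sup>T)"
proof (rule sym_adjoint_eqI)
  let ?P = "C\<^sup>T * Z * C"
  have P: "?P \<in> carrier_mat N N" using C Z by auto
  show "(1 / 2) \<cdot>\<^sub>m (?P + ?P\<^sup>T) \<in> sym_mats N"
    using P C unfolding sym_mats_def by (auto intro!: eq_matI simp del: index_mult_mat(1))
  fix Y assume Y: "Y \<in> sym_mats N"
  then have Yc: "Y \<in> carrier_mat N N" and "Y\<^sup>T = Y" by (auto simp: sym_mats_def)
  then have s: "Y $$ (j, i) = Y $$ (i, j)" if "i < N" "j < N" for i j
    using that by (metis carrier_matD index_transpose_mat(1))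
  have sw: "(\<Sum>i<N. \<Sum>j<N. Y $$ (i, j) * ?P $$ (j, i)) = (\<Sum>i<N. \<Sum>j<N. Y $$ (i, j) * ?P $$ (i, j))"
  proof -
    have "(\<Sum>i<N. \<Sum>j<N. Y $$ (i, j) * ?P $$ (j, i)) = (\<Sum>j<N. \<Sum>i<N. Y $$ (i, j) * ?P $$ (j, i))"
      by (rule sum.swap)
    also have "\<dots> = (\<Sum>j<N. \<Sum>i<N. Y $$ (j, i) * ?P $$ (j, i))"
      by (intro sum.cong refl) (simp add: s del: index_mult_mat(1))
    finally show ?thesis .
  qed
  have "mat_inner Y ((1 / 2) \<cdot>\<^sub>m (?P + ?P\<^sup>T))
      = (\<Sum>i<N. \<Sum>j<N. (Y $$ (i, j) * ?P $$ (i, j) + Y $$ (i, j) * ?P $$ (j, i)) / 2)"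
  proof (subst mat_inner_sum[OF Yc])
    show "(1 / 2) \<cdot>\<^sub>m (?P + ?P\<^sup>T) \<in> carrier_mat N N" using P by auto
    show "(\<Sum>i<N. \<Sum>j<N. Y $$ (i, j) * ((1 / 2) \<cdot>\<^sub>m (?P + ?P\<^sup>T)) $$ (i, j))
      = (\<Sum>i<N. \<Sum>j<N. (Y $$ (i, j) * ?P $$ (i, j) + Y $$ (i, j) * ?P $$ (j, i)) / 2)"
      using P C by (intro sum.cong refl) (simp add: field_simps del: index_mult_mat(1))
  qed
  also have "\<dots> = mat_inner Y ?P"
    unfolding mat_inner_sum[OF Yc P]
    by (simp add: sum_divide_distrib[symmetric] sum.distrib sw del: index_mult_mat(1))
  finally show "mat_inner (C * Y * C\<^sup>T) Z = mat_inner Y ((1 / 2) \<cdot>\<^sub>m (?P + ?P\<^sup>T))"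
    using mat_inner_congruence[OF C Yc Z] by simp
qed

lemma A_adj_eq:
  assumes "A \<in> carrier_mat m n" "b \<in> carrier_vec m" "\<Gamma> \<in> sym_mats m"
  shows "A_adj n m A b \<Gamma> = (A_ext n m A b)\<^sup>T * \<Gamma> * A_ext n m A b"
proof -
  let ?C = "A_ext n m A b"
  have C: "?C \<in> carrier_mat m (n + 1)"
    using assms unfolding A_ext_def by (auto simp: mat_of_cols_def)
  have G: "\<Gamma> \<in> carrier_mat m m" "\<Gamma>\<^sup>T = \<Gamma>" using assms by (auto simp: sym_mats_def)
  have t: "(?C\<^sup>T * \<Gamma> * ?C)\<^sup>T = ?C\<^sup>T * \<Gamma> * ?C"
  proof -
    have "(?C\<^sup>T * \<Gamma> * ?C)\<^sup>T = ?C\<^sup>T * (?C\<^sup>T * \<Gamma>)\<^sup>T"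
      using C G by (intro transpose_mult[of _ "n + 1" m _ "n + 1"]) auto
    also have "(?C\<^sup>T * \<Gamma>)\<^sup>T = \<Gamma>\<^sup>T * ?C\<^sup>T\<^sup>T"
      using C G by (intro transpose_mult[of _ "n + 1" m _ m]) auto
    also have "?C\<^sup>T * (\<Gamma>\<^sup>T * ?C\<^sup>T\<^sup>T) = ?C\<^sup>T * \<Gamma> * ?C"
      using C G by (simp add: assoc_mult_mat[of _ "n + 1" m _ m _ "n + 1"])
    finally show ?thesis .
  qed
  have "A_map n m A b = (\<lambda>Y. ?C * Y * ?C\<^sup>T)" by (rule ext) (simp add: A_map_def)
  then have "A_adj n m A b \<Gamma> = (1 / 2) \<cdot>\<^sub>m (?C\<^sup>T * \<Gamma> * ?C + ?C\<^sup>T * \<Gamma> * ?C)"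
    unfolding A_adj_def using sym_adjoint_congruence[OF C G(1)] t by simp
  then show ?thesis by (auto intro!: eq_matI simp del: index_mult_mat(1))
qed

lemma B_adj_eq:
  assumes "B \<in> carrier_mat l n" "d \<in> carrier_vec l" "\<Lambda> \<in> carrier_mat (l + 1) (l + 1)"
  shows "B_adj n l B d \<Lambda> = (1 / 2) \<cdot>\<^sub>m
    ((B_ext n l B d)\<^sup>T * \<Lambda> * B_ext n l B d + ((B_ext n l B d)\<^sup>T * \<Lambda> * B_ext n l B d)\<^sup>T)"
proof -
  let ?C = "B_ext n l B d"
  have C: "?C \<in> carrier_mat (l + 1) (n + 1)"
    using assms unfolding B_ext_def by (auto simp: mat_of_cols_def)
  have "B_map n l B d = (\<lambda>Y. ?C * Y * ?C\<^sup>T)" by (rule ext) (simp add: B_map_def)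
  then show ?thesis
    unfolding B_adj_def using sym_adjoint_congruence[OF C assms(3)] by simp
qed

lemma D_map_entries:
  assumes "Y \<in> carrier_mat (n + 1) (n + 1)"
  shows "D_map k Y = mat (n + 1) (n + 1) (\<lambda>(i, j).
    if i = 0 \<and> j = 0 then real k * Y $$ (0, 0) else if i = 0 \<or> j = 0 \<or> i = j then Y $$ (i, j) else 0)"
  using assms unfolding D_map_def split_block_def Let_def Diag_def mat_diag_def
  by (intro eq_matI) auto

lemma D_adj_eq:
  assumes W: "W \<in> sym_mats (n + 1)"
  shows "D_adj n k W = D_map k W"
  unfolding D_adj_def
proof (rule sym_adjoint_eqI)
  have c: "W \<in> carrier_mat (n + 1) (n + 1)" and t: "W\<^sup>T = W"
    using W by (auto simp: sym_mats_def)
  have s: "W $$ (j, i) = W $$ (i, j)" if "i < n + 1" "j < n + 1" for i j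
    using that c t by (metis carrier_matD index_transpose_mat(1))
  show "D_map k W \<in> sym_mats (n + 1)"
    unfolding sym_mats_def D_map_entries[OF c] by (auto intro!: eq_matI simp: s)
  fix Y assume "Y \<in> sym_mats (n + 1)"
  then have Y: "Y \<in> carrier_mat (n + 1) (n + 1)" by (auto simp: sym_mats_def)
  have D: "D_map k Y \<in> carrier_mat (n + 1) (n + 1)" "D_map k W \<in> carrier_mat (n + 1) (n + 1)"
    unfolding D_map_entries[OF c] D_map_entries[OF Y] by auto
  show "mat_inner (D_map k Y) W = mat_inner Y (D_map k W)"
    unfolding mat_inner_sum[OF D(1) c] mat_inner_sum[OF Y D(2)]
    by (intro sum.cong refl) (auto simp: D_map_entries[OF c] D_map_entries[OF Y])
qed

end

theory Submission
  imports Defs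
begin

text \<open>
  Let \<open>y = (1, x)\<close> for a feasible \<open>(x, z)\<close>, and let \<open>T\<close> be the set of indices with \<open>z\<^sub>i = 1\<close>.
  Testing the dual equality against \<open>y y\<^sup>T\<close> bounds the gap \<open>obj(x) - \<alpha>\<close> from below by
  \<open>k W\<^sub>1\<^sub>1\<close> plus the sum of \<open>2 (W\<^sub>1\<^sub>2)\<^sub>i x\<^sub>i + (W\<^sub>2\<^sub>2)\<^sub>i\<^sub>i x\<^sub>i\<^sup>2\<close>, whose terms are at least
  \<open>- w\<^sub>i\<close> and vanish off \<open>T\<close>. Since \<open>|T| \<le> k\<close> and the 2 x 2 principal minors of \<open>W\<close> give
  \<open>w\<^sub>i \<le> W\<^sub>1\<^sub>1\<close>, the gap is a sum of \<open>k\<close> nonnegative terms, one of them \<open>W\<^sub>1\<^sub>1 - w\<^sub>i\<close> for each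
  \<open>i\<close> in \<open>T\<close>. If \<open>p\<close> is in \<open>T\<close>, the gap is at least \<open>w\<^bsub>[k]\<^esub> - w\<^sub>p\<close>. If \<open>p\<close> is not in \<open>T\<close> and
  \<open>|T| = k\<close>, some index in \<open>T \<union> {p}\<close> has score at most \<open>w\<^bsub>[k+1]\<^esub>\<close>; it gives the bound
  \<open>w\<^sub>p - w\<^bsub>[k+1]\<^esub>\<close>, as does a leftover term \<open>W\<^sub>1\<^sub>1\<close> when \<open>|T| < k\<close>.
\<close>

section \<open>Quadratic forms of congruences, nonnegative and positive semidefinite
  matrices\<close>

lemma quadratic_form_sum:
  assumes "M \<in> carrier_mat N N" "v \<in> carrier_vec N"
  shows "v \<bullet> (M *\<^sub>v v) = (\<Sum>i<N. \<Sum>j<N. v $ i * M $$ (i, j) * v $ j)"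
  using assms
  by (simp add: scalar_prod_def lessThan_atLeast0 sum_distrib_left mult_ac)

lemma quadratic_form_transpose:
  fixes M :: "real mat"
  assumes "M \<in> carrier_mat N N" "v \<in> carrier_vec N"
  shows "v \<bullet> (M\<^sup>T *\<^sub>v v) = v \<bullet> (M *\<^sub>v v)"
  using assms transpose_vec_mult_scalar[of M N N v v]
  by (simp add: comm_scalar_prod[of _ N])

text \<open>Moves a form in an adjoint image onto \<open>C y\<close>, the vector on which the primal
  constraints give information.\<close>

lemma quadratic_form_congruence:
  fixes C Z :: "real mat"
  assumes C: "C \<in> carrier_mat K N" and Z: "Z \<in> carrier_mat K K" and y: "y \<in> carrier_vec N"
  shows "y \<bullet> ((C\<^sup>T * Z * C) *\<^sub>v y) = (C *\<^sub>v y) \<bullet> (Z *\<^sub>v (C *\<^sub>v y))"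
proof -
  have Cy: "C *\<^sub>v y \<in> carrier_vec K" using C y by simp
  have "(C\<^sup>T * Z * C) *\<^sub>v y = C\<^sup>T *\<^sub>v (Z *\<^sub>v (C *\<^sub>v y))"
    using C Z y Cy
    by (subst assoc_mult_mat_vec[of _ N K], auto simp del: assoc_mult_mat_vec)
      (subst assoc_mult_mat_vec[of _ N K], auto)
  moreover have "y \<bullet> (C\<^sup>T *\<^sub>v (Z *\<^sub>v (C *\<^sub>v y))) = (C\<^sup>T *\<^sub>v (Z *\<^sub>v (C *\<^sub>v y))) \<bullet> y"
    using C Z y by (intro comm_scalar_prod[of _ N]) auto
  moreover have "\<dots> = (Z *\<^sub>v (C *\<^sub>v y)) \<bullet> (C *\<^sub>v y)"
    using C Z y by (intro transpose_vec_mult_scalar[of _ K N]) auto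
  moreover have "\<dots> = (C *\<^sub>v y) \<bullet> (Z *\<^sub>v (C *\<^sub>v y))"
    using Cy Z by (intro comm_scalar_prod[of _ K]) auto
  ultimately show ?thesis by simp
qed

lemma quadratic_form_nonneg:
  assumes M: "M \<in> nonneg_mats N" and v: "v \<in> carrier_vec N" and "\<And>i. i < N \<Longrightarrow> 0 \<le> v $ i"
  shows "0 \<le> v \<bullet> (M *\<^sub>v v)"
proof -
  have "M \<in> carrier_mat N N" using M by (simp add: nonneg_mats_def)
  then show ?thesis
    using assms by (auto simp: quadratic_form_sum nonneg_mats_def intro!: sum_nonneg)
qed

text \<open>The form of \<open>W\<close> at the vector with \<open>t\<close> in position
  \<open>i\<close>, \<open>s\<close> in position \<open>j\<close> and 0 elsewhere. Leaving
  \<open>t\<close> and \<open>s\<close> free gives every consequence of the 2 x 2 principal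
  submatrix.\<close>

lemma psd_mats_two_entries:
  assumes W: "W \<in> psd_mats N" and "i < N" "j < N" "i \<noteq> j"
  shows "0 \<le> t\<^sup>2 * W $$ (i, i) + 2 * t * s * W $$ (i, j) + s\<^sup>2 * W $$ (j, j)"
proof -
  have c: "W \<in> carrier_mat N N" "W\<^sup>T = W" using W by (auto simp: psd_mats_def sym_mats_def)
  have sym: "W $$ (j, i) = W $$ (i, j)"
    using assms c by (metis carrier_matD index_transpose_mat(1))
  let ?f = "\<lambda>a. (if a = i then t else 0) + (if a = j then s else 0)"
  define v where "v = vec N ?f"
  have v: "v \<in> carrier_vec N" by (simp add: v_def)
  have "v \<bullet> (W *\<^sub>v v) = (\<Sum>a<N. \<Sum>b<N. ?f a * W $$ (a, b) * ?f b)"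
    unfolding quadratic_form_sum[OF c(1) v] by (simp add: v_def)
  also have "\<dots> = (\<Sum>a<N. ?f a * (W $$ (a, i) * t + W $$ (a, j) * s))"
    using assms
    by (simp add: distrib_left sum.distrib if_distrib[of "(*) _"] mult.assoc cong: if_cong)
  also have "\<dots> = t * (W $$ (i, i) * t + W $$ (i, j) * s) + s * (W $$ (j, i) * t + W $$ (j, j) * s)"
    using assms
    by (simp add: distrib_right sum.distrib if_distribR if_distrib[of "\<lambda>x. x * _"] cong: if_cong)
  finally have "v \<bullet> (W *\<^sub>v v) = t\<^sup>2 * W $$ (i, i) + 2 * t * s * W $$ (i, j) + s\<^sup>2 * W $$ (j, j)"
    using sym by (simp add: power2_eq_square algebra_simps)
  then show ?thesis using W v unfolding psd_mats_def by fastforce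
qed

section \<open>Scores and the corner entry of \<open>W\<close>\<close>

lemma score_vec_index:
  assumes "W \<in> carrier_mat (n + 1) (n + 1)" "i < n"
  shows "score_vec n W $ i =
    (if W $$ (Suc i, Suc i) > 0 then (W $$ (0, Suc i))\<^sup>2 / W $$ (Suc i, Suc i) else 0)"
  using assms by (simp add: score_vec_def split_block_def Let_def)

text \<open>Both bounds concern the 2 x 2 principal submatrix at 0 and \<open>Suc i\<close>: the
  first is its determinant condition, the second a completed square. A zero diagonal entry forces a
  zero border entry, so both survive the default score 0.\<close>

lemma score_vec_bounds:
  assumes W: "W \<in> psd_mats (n + 1)" and i: "i < n"
  shows "score_vec n W $ i \<le> W $$ (0, 0)"
    and "- score_vec n W $ i \<le> 2 * W $$ (0, Suc i) * s + W $$ (Suc i, Suc i) * s\<^sup>2"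
proof -
  have c: "W \<in> carrier_mat (n + 1) (n + 1)" using W by (auto simp: psd_mats_def sym_mats_def)
  define a u r where "a = W $$ (0, 0)" "u = W $$ (0, Suc i)" "r = W $$ (Suc i, Suc i)"
  note defs = this
  have q: "0 \<le> t\<^sup>2 * a + 2 * t * s * u + s\<^sup>2 * r" for t s
    using psd_mats_two_entries[OF W, of 0 "Suc i" t s] i by (simp add: defs)
  have a: "0 \<le> a" and r: "0 \<le> r" using q[of 1 0] q[of 0 1] by auto
  have idx: "score_vec n W $ i = (if r > 0 then u\<^sup>2 / r else 0)"
    using score_vec_index[OF c i] by (simp add: defs)
  \<comment> \<open>With \<open>r = 0\<close> the form is affine in \<open>s\<close>; the chosen
    \<open>s\<close> makes it \<open>a - (a + 1) = -1\<close>.\<close>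
  have u0: "u = 0" if "r = 0"
  proof (rule ccontr)
    assume "u \<noteq> 0"
    then show False using q[of 1 "- (a + 1) / (2 * u)"] that by (simp add: field_simps)
  qed
  \<comment> \<open>At \<open>t = 1\<close> the form is minimal at \<open>s = - u / r\<close>, with
    value \<open>a - u\<^sup>2 / r\<close>.\<close>
  show "score_vec n W $ i \<le> W $$ (0, 0)"
    using q[of 1 "- u / r"] a unfolding idx defs(1)[symmetric]
    by (auto simp: power2_eq_square field_simps)
  have "0 \<le> (u + r * s)\<^sup>2 / r" using r by simp
  then have "- (u\<^sup>2 / r) \<le> 2 * u * s + r * s\<^sup>2" if "r > 0"
    using that by (simp add: power2_eq_square field_simps)
  then show "- score_vec n W $ i \<le> 2 * W $$ (0, Suc i) * s + W $$ (Suc i, Suc i) * s\<^sup>2"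
    using u0 r unfolding idx defs[symmetric] by auto
qed

section \<open>The i-th largest entry\<close>

lemma nth_largest_mem:
  assumes "0 < i" "i \<le> dim_vec w"
  shows "\<exists>j < dim_vec w. nth_largest w i = w $ j"
proof -
  have "rev (sort (list_of_vec w)) ! (i - 1) \<in> set (rev (sort (list_of_vec w)))"
    using assms by (intro nth_mem) simp
  then have "nth_largest w i \<in> set (list_of_vec w)" by (simp add: nth_largest_def)
  then show ?thesis by (auto simp: in_set_conv_nth list_of_vec_index)
qed

text \<open>Otherwise at least \<open>i\<close> entries would exceed the i-th largest one, but in
  decreasing order these can only occupy the \<open>i - 1\<close> positions before it.\<close>

lemma le_nth_largest_of_card:
  assumes T: "T \<subseteq> {..<dim_vec w}" and card: "card T = i" and i: "0 < i"
  shows "\<exists>j \<in> T. w $ j \<le> nth_largest w i"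
proof (rule ccontr)
  let ?L = "list_of_vec w"
  let ?R = "rev (sort ?L)"
  assume "\<not> ?thesis"
  then have "T \<subseteq> {j. j < length ?L \<and> ?L ! j > nth_largest w i}"
    using T by (auto simp: list_of_vec_index)
  then have "i \<le> card {j. j < length ?L \<and> ?L ! j > nth_largest w i}"
    unfolding card[symmetric] by (intro card_mono) auto
  \<comment> \<open>Sorting permutes positions, so the count is carried over through the multiset of
    entries.\<close>
  also have "\<dots> = size (filter_mset (\<lambda>y. y > nth_largest w i) (mset ?L))"
    by (simp add: length_filter_conv_card flip: mset_filter)
  also have "\<dots> = size (filter_mset (\<lambda>y. y > nth_largest w i) (mset ?R))"
    by simp
  also have "\<dots> = card {j. j < length ?R \<and> ?R ! j > nth_largest w i}"
    by (simp only: mset_filter[symmetric] size_mset length_filter_conv_card)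
  also have "\<dots> \<le> card {..<i - 1}"
  proof (intro card_mono subsetI)
    fix j assume j: "j \<in> {j. j < length ?R \<and> ?R ! j > nth_largest w i}"
    show "j \<in> {..<i - 1}"
    proof (rule ccontr)
      assume "j \<notin> {..<i - 1}"
      then have "?R ! j \<le> ?R ! (i - 1)"
        using j sorted_rev_nth_mono[of ?R "i - 1" j] by simp
      then show False using j by (simp add: nth_largest_def)
    qed
  qed simp
  finally show False using i by simp
qed

section \<open>The terms of the dual equality at the vector (1, x)\<close>

definition homogenize :: "real vec \<Rightarrow> real vec" where
  "homogenize x = vec 1 (\<lambda>_. 1) @\<^sub>v x"

lemma homogenize_carrier [simp]: "x \<in> carrier_vec n \<Longrightarrow> homogenize x \<in> carrier_vec (Suc n)"
  by (rule carrier_vecI) (simp add: homogenize_def)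

lemma homogenize_index [simp]:
  "homogenize x $ 0 = 1" "i < dim_vec x \<Longrightarrow> homogenize x $ Suc i = x $ i"
  by (auto simp: homogenize_def)

lemma homogenize_form:
  assumes M: "M \<in> carrier_mat (n + 1) (n + 1)" and x: "x \<in> carrier_vec n"
  shows "homogenize x \<bullet> (M *\<^sub>v homogenize x) =
    M $$ (0, 0) + (\<Sum>j<n. M $$ (0, Suc j) * x $ j)
    + (\<Sum>i<n. x $ i * M $$ (Suc i, 0) + (\<Sum>j<n. x $ i * M $$ (Suc i, Suc j) * x $ j))"
proof -
  have y: "homogenize x \<in> carrier_vec (n + 1)" using x by simp
  show ?thesis
    using x unfolding quadratic_form_sum[OF M y]
    by (simp add: sum.lessThan_Suc_shift del: sum.lessThan_Suc)
qed

lemma Qbar_form: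
  assumes "Q \<in> carrier_mat n n" "c \<in> carrier_vec n" "x \<in> carrier_vec n"
  shows "homogenize x \<bullet> (Qbar n Q c *\<^sub>v homogenize x) = miqp_objective Q c x"
proof -
  have C: "Qbar n Q c \<in> carrier_mat (n + 1) (n + 1)"
    using assms unfolding Qbar_def by (auto simp: mat_of_cols_def mat_of_rows_def)
  have "homogenize x \<bullet> (Qbar n Q c *\<^sub>v homogenize x)
    = (\<Sum>j<n. c $ j * x $ j) + (\<Sum>i<n. x $ i * c $ i + (\<Sum>j<n. x $ i * Q $$ (i, j) * x $ j))"
    using assms unfolding homogenize_form[OF C assms(3)]
    by (simp add: Qbar_def mat_of_cols_def mat_of_rows_def)
  also have "\<dots> = miqp_objective Q c x"
    using assms quadratic_form_sum[of Q n x]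
    by (simp add: miqp_objective_def scalar_prod_def[of c] lessThan_atLeast0 sum.distrib mult_ac)
  finally show ?thesis .
qed

text \<open>The product is \<open>A x - b\<close>; its vanishing removes the sign-free multiplier
  \<Gamma> from the gap.\<close>

lemma A_ext_homogenize:
  assumes "A \<in> carrier_mat m n" "b \<in> carrier_vec m" "x \<in> carrier_vec n" "A *\<^sub>v x = b"
  shows "A_ext n m A b *\<^sub>v homogenize x = 0\<^sub>v m"
  using assms unfolding A_ext_def homogenize_def
  by (subst four_block_mat_mult_vec[of _ m 1 _ n _ 0])
     (auto intro!: eq_vecI simp: mat_of_cols_def scalar_prod_def)

text \<open>The top row (1, 0) reproduces the leading 1, so \<open>B x \<ge> d\<close> makes the
  whole image nonnegative.\<close>

lemma B_ext_homogenize: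
  assumes "B \<in> carrier_mat l n" "d \<in> carrier_vec l" "x \<in> carrier_vec n"
  shows "B_ext n l B d *\<^sub>v homogenize x = homogenize (B *\<^sub>v x - d)"
  using assms unfolding B_ext_def homogenize_def
  by (subst four_block_mat_mult_vec[of _ 1 1 _ n _ l])
     (auto intro!: eq_vecI simp: mat_of_cols_def scalar_prod_def)

text \<open>Because \<open>Diag\<close> removes the off-diagonal entries of the lower block, the
  form separates over coordinates; symmetry merges the two borders into the factor 2.\<close>

lemma D_map_form:
  assumes W: "W \<in> sym_mats (n + 1)" and x: "x \<in> carrier_vec n"
  shows "homogenize x \<bullet> (D_map k W *\<^sub>v homogenize x) =
    real k * W $$ (0, 0) + (\<Sum>i<n. 2 * W $$ (0, Suc i) * x $ i + W $$ (Suc i, Suc i) * (x $ i)\<^sup>2)"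
proof -
  have c: "W \<in> carrier_mat (n + 1) (n + 1)" and t: "W\<^sup>T = W"
    using W by (auto simp: sym_mats_def)
  have s: "W $$ (Suc i, 0) = W $$ (0, Suc i)" if "i < n" for i
    using that c t by (metis Suc_eq_plus1 Suc_less_eq carrier_matD index_transpose_mat(1) zero_less_Suc)
  have D: "D_map k W \<in> carrier_mat (n + 1) (n + 1)"
    by (simp add: D_map_entries[OF c])
  have "homogenize x \<bullet> (D_map k W *\<^sub>v homogenize x) =
    real k * W $$ (0, 0) + (\<Sum>j<n. W $$ (0, Suc j) * x $ j)
    + (\<Sum>i<n. x $ i * W $$ (Suc i, 0)
        + (\<Sum>j<n. if i = j then x $ i * W $$ (Suc i, Suc i) * x $ i else 0))"
    unfolding homogenize_form[OF D x]
    by (simp add: D_map_entries[OF c] if_distrib[of "\<lambda>y. y * _"] if_distrib[of "(*) _"] cong: if_cong)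
  also have "\<dots> = real k * W $$ (0, 0)
    + (\<Sum>i<n. 2 * W $$ (0, Suc i) * x $ i + W $$ (Suc i, Suc i) * (x $ i)\<^sup>2)"
    by (simp add: s sum.distrib sum_distrib_left power2_eq_square mult_ac)
  finally show ?thesis .
qed

lemma E11_form:
  assumes "x \<in> carrier_vec n"
  shows "homogenize x \<bullet> (E11 (n + 1) *\<^sub>v homogenize x) = 1"
proof -
  have "E11 (n + 1) \<in> carrier_mat (n + 1) (n + 1)" by (simp add: E11_def)
  from homogenize_form[OF this assms] show ?thesis by (simp add: E11_def)
qed

section \<open>Lower bounds on the gap\<close>

lemma weak_duality:
  assumes Q: "Q \<in> sym_mats n" and c: "c \<in> carrier_vec n"
    and A: "A \<in> carrier_mat m n" and b: "b \<in> carrier_vec m"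
    and B: "B \<in> carrier_mat l n" and d: "d \<in> carrier_vec l"
    and dual: "(\<alpha>, \<Gamma>, \<Lambda>, W, S) \<in> dual_feasible n m l k Q c A b B d"
    and feas: "(x, z) \<in> miqp_feasible n k A b B d"
  shows "real k * W $$ (0, 0) + (\<Sum>i<n. 2 * W $$ (0, Suc i) * x $ i + W $$ (Suc i, Suc i) * (x $ i)\<^sup>2)
    \<le> miqp_objective Q c x - \<alpha>"
proof -
  let ?N = "n + 1" and ?CA = "A_ext n m A b" and ?CB = "B_ext n l B d"
  define y where "y = homogenize x"
  define MA MB MD where "MA = A_adj n m A b \<Gamma>" "MB = B_adj n l B d \<Lambda>" "MD = D_adj n k W"
  note M_defs = this
  have x: "x \<in> carrier_vec n" "A *\<^sub>v x = b" "d \<le> B *\<^sub>v x"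
    using feas by (auto simp: miqp_feasible_def)
  have y: "y \<in> carrier_vec ?N" using x by (simp add: y_def)
  have G: "\<Gamma> \<in> sym_mats m" "\<Gamma> \<in> carrier_mat m m"
    and L: "\<Lambda> \<in> nonneg_mats (l + 1)" "\<Lambda> \<in> carrier_mat (l + 1) (l + 1)"
    and W: "W \<in> sym_mats ?N" "W \<in> carrier_mat ?N ?N"
    and S: "S \<in> psd_mats ?N" "S \<in> carrier_mat ?N ?N"
    and eq: "Qbar n Q c - MA - MB - MD - S - \<alpha> \<cdot>\<^sub>m E11 ?N = 0\<^sub>m ?N ?N"
    using dual
    by (auto simp: dual_feasible_def sym_mats_def nonneg_mats_def psd_mats_def M_defs)
  have CA: "?CA \<in> carrier_mat m ?N" and CB: "?CB \<in> carrier_mat (l + 1) ?N"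
    using A B by (auto simp: A_ext_def B_ext_def mat_of_cols_def)
  have MA: "MA = ?CA\<^sup>T * \<Gamma> * ?CA"
    unfolding M_defs by (rule A_adj_eq[OF A b G(1)])
  let ?P = "?CB\<^sup>T * \<Lambda> * ?CB"
  have MB: "MB = (1 / 2) \<cdot>\<^sub>m (?P + ?P\<^sup>T)"
    unfolding M_defs by (rule B_adj_eq[OF B d L(2)])
  have MD: "MD = D_map k W"
    unfolding M_defs by (rule D_adj_eq[OF W(1)])
  have P: "?P \<in> carrier_mat ?N ?N" using CB L by auto
  have carr: "Qbar n Q c \<in> carrier_mat ?N ?N" "MA \<in> carrier_mat ?N ?N" "MB \<in> carrier_mat ?N ?N"
    "MD \<in> carrier_mat ?N ?N" "E11 ?N \<in> carrier_mat ?N ?N"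
    using Q CA G P
    by (auto simp: Qbar_def MA MB MD D_map_entries[OF W(2)] E11_def mat_of_cols_def
        mat_of_rows_def sym_mats_def)
  have "Qbar n Q c $$ (i, j) = MA $$ (i, j) + MB $$ (i, j) + MD $$ (i, j) + S $$ (i, j)
      + \<alpha> * E11 ?N $$ (i, j)" if "i < ?N" "j < ?N" for i j
    using arg_cong[OF eq, of "\<lambda>M. M $$ (i, j)"] carr S that by simp
  then have "y \<bullet> (Qbar n Q c *\<^sub>v y) = (\<Sum>i<?N. \<Sum>j<?N. y $ i * (MA $$ (i, j) + MB $$ (i, j)
      + MD $$ (i, j) + S $$ (i, j) + \<alpha> * E11 ?N $$ (i, j)) * y $ j)"
    unfolding quadratic_form_sum[OF carr(1) y] by (intro sum.cong refl) simp
  also have "\<dots> = y \<bullet> (MA *\<^sub>v y) + y \<bullet> (MB *\<^sub>v y) + y \<bullet> (MD *\<^sub>v y) + y \<bullet> (S *\<^sub>v y)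
      + \<alpha> * (y \<bullet> (E11 ?N *\<^sub>v y))"
    unfolding quadratic_form_sum[OF carr(2) y] quadratic_form_sum[OF carr(3) y]
      quadratic_form_sum[OF carr(4) y] quadratic_form_sum[OF carr(5) y]
      quadratic_form_sum[OF S(2) y] sum_distrib_left sum.distrib[symmetric]
    by (intro sum.cong refl) (simp add: algebra_simps)
  finally have "miqp_objective Q c x = y \<bullet> (MA *\<^sub>v y) + y \<bullet> (MB *\<^sub>v y) + y \<bullet> (MD *\<^sub>v y)
      + y \<bullet> (S *\<^sub>v y) + \<alpha>"
    using Qbar_form[of Q n c x] E11_form[of x n] Q c x by (simp add: y_def sym_mats_def)
  moreover have "y \<bullet> (MA *\<^sub>v y) = 0"
    unfolding MA quadratic_form_congruence[OF CA G(2) y]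
    using A_ext_homogenize[OF A b x(1,2)] G(2) by (simp add: y_def)
  moreover have "0 \<le> y \<bullet> (MB *\<^sub>v y)"
  proof -
    have "0 \<le> (?CB *\<^sub>v y) \<bullet> (\<Lambda> *\<^sub>v (?CB *\<^sub>v y))"
    proof (rule quadratic_form_nonneg[OF L(1)])
      show "?CB *\<^sub>v y \<in> carrier_vec (l + 1)" using CB y by simp
      fix i assume "i < l + 1"
      then show "0 \<le> (?CB *\<^sub>v y) $ i"
        using x B d unfolding y_def B_ext_homogenize[OF B d x(1)]
        by (cases i) (auto simp: less_eq_vec_def)
    qed
    then have "0 \<le> y \<bullet> (?P *\<^sub>v y)" by (simp only: quadratic_form_congruence[OF CB L(2) y])
    \<comment> \<open>\<Lambda> need not be symmetric, so its adjoint image is the symmetric part of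
      \<open>?P\<close>, which has the same quadratic form as \<open>?P\<close>.\<close>
    moreover have "y \<bullet> (MB *\<^sub>v y) = (y \<bullet> (?P *\<^sub>v y) + y \<bullet> (?P\<^sup>T *\<^sub>v y)) / 2"
    proof -
      have Pt: "?P\<^sup>T \<in> carrier_mat ?N ?N" using P by simp
      show ?thesis
        unfolding quadratic_form_sum[OF carr(3) y] quadratic_form_sum[OF P y]
          quadratic_form_sum[OF Pt y] sum.distrib[symmetric] sum_divide_distrib
        using P Pt CB by (intro sum.cong refl) (simp add: MB algebra_simps del: index_mult_mat(1))
    qed
    ultimately show ?thesis using quadratic_form_transpose[OF P y] by simp
  qed
  moreover have "0 \<le> y \<bullet> (S *\<^sub>v y)" using S(1) y by (simp add: psd_mats_def)
  ultimately show ?thesis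
    using D_map_form[OF W(1) x(1), of k] by (simp add: MD y_def)
qed

text \<open>Of the \<open>k\<close> copies of \<open>W $$ (0, 0)\<close>, one is assigned to each
  index of \<open>T\<close>, where it outweighs the score; \<open>card T \<le> k\<close> leaves the
  remaining coefficient nonnegative.\<close>

lemma gap_bound:
  assumes Q: "Q \<in> sym_mats n" and c: "c \<in> carrier_vec n"
    and A: "A \<in> carrier_mat m n" and b: "b \<in> carrier_vec m"
    and B: "B \<in> carrier_mat l n" and d: "d \<in> carrier_vec l"
    and dual: "(\<alpha>, \<Gamma>, \<Lambda>, W, S) \<in> dual_feasible n m l k Q c A b B d"
    and feas: "(x, z) \<in> miqp_feasible n k A b B d"
  defines "T \<equiv> {i. i < n \<and> z $ i = 1}"
  shows "card T \<le> k"
    and "(real k - real (card T)) * W $$ (0, 0) + (\<Sum>i\<in>T. W $$ (0, 0) - score_vec n W $ i)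
      \<le> miqp_objective Q c x - \<alpha>"
proof -
  have x: "x \<in> carrier_vec n" and z: "z \<in> carrier_vec n"
    and compl: "entrywise_prod x (ones_vec n - z) = 0\<^sub>v n"
    and sum_z: "ones_vec n \<bullet> z \<le> real k" and bin: "\<And>i. i < n \<Longrightarrow> z $ i = 0 \<or> z $ i = 1"
    using feas by (auto simp: miqp_feasible_def)
  have W: "W \<in> psd_mats (n + 1)" using dual by (auto simp: dual_feasible_def)
  have T: "finite T" "T \<subseteq> {..<n}" by (auto simp: T_def)
  have "z $ i = (if i \<in> T then 1 else 0)" if "i < n" for i
    using bin[OF that] that by (auto simp: T_def)
  then have "ones_vec n \<bullet> z = (\<Sum>i<n. if i \<in> T then 1 else 0)"
    using z by (auto simp: scalar_prod_def ones_vec_def lessThan_atLeast0 intro!: sum.cong)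
  also have "\<dots> = real (card T)"
    using T by (simp add: sum.If_cases Int_absorb1)
  finally show "card T \<le> k" using sum_z by simp
  \<comment> \<open>Off \<open>T\<close> the factor \<open>1 - z $ i\<close> is 1, so
    complementarity forces \<open>x $ i = 0\<close>.\<close>
  have x0: "x $ i = 0" if "i < n" "i \<notin> T" for i
    using arg_cong[OF compl, of "\<lambda>v. v $ i"] that x z bin[of i]
    by (auto simp: T_def entrywise_prod_def ones_vec_def)
  have "(\<Sum>i\<in>T. - score_vec n W $ i)
      \<le> (\<Sum>i\<in>T. 2 * W $$ (0, Suc i) * x $ i + W $$ (Suc i, Suc i) * (x $ i)\<^sup>2)"
    using T score_vec_bounds(2)[OF W] by (intro sum_mono) auto
  also have "\<dots> = (\<Sum>i<n. 2 * W $$ (0, Suc i) * x $ i + W $$ (Suc i, Suc i) * (x $ i)\<^sup>2)"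
    using T x0 by (intro sum.mono_neutral_left) auto
  finally show "(real k - real (card T)) * W $$ (0, 0) + (\<Sum>i\<in>T. W $$ (0, 0) - score_vec n W $ i)
      \<le> miqp_objective Q c x - \<alpha>"
    using weak_duality[OF Q c A b B d dual feas]
    by (simp add: sum_subtractf sum_negf algebra_simps)
qed

section \<open>Fixing a binary variable from the gap\<close>

lemma miqp_optimal_le:
  assumes "(x, z) \<in> miqp_optimal n k Q c A b B d" "miqp_value n k Q c A b B d \<le> ereal u"
  shows "miqp_objective Q c x \<le> u"
proof -
  have "ereal (miqp_objective Q c x) \<le> miqp_value n k Q c A b B d"
    using assms(1) unfolding miqp_value_def miqp_optimal_def by (intro INF_greatest) auto
  then show ?thesis using assms(2) by (metis ereal_less_eq(3) order_trans)
qed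

theorem theorem4:
  fixes n m l k p :: nat
    and Q A B \<Gamma> \<Lambda> W S :: "real mat"
    and c b d x z :: "real vec"
    and vUB vLB \<alpha> :: real
  assumes Q: "Q \<in> sym_mats n"
    and c: "c \<in> carrier_vec n"
    and A: "A \<in> carrier_mat m n"
    and A_rank: "vec_space.rank m A = m"
    and b: "b \<in> carrier_vec m"
    and B: "B \<in> carrier_mat l n"
    and d: "d \<in> carrier_vec l"
    and k: "0 < k" "k < n"
    and feasible: "miqp_feasible n k A b B d \<noteq> {}"
    and bounded: "miqp_value n k Q c A b B d > - \<infinity>"
    and vUB: "miqp_value n k Q c A b B d \<le> ereal vUB"
    and dual: "(\<alpha>, \<Gamma>, \<Lambda>, W, S) \<in> dual_feasible n m l k Q c A b B d"
    and vLB: "vLB = \<alpha>"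
    and p: "p < n"
    and opt: "(x, z) \<in> miqp_optimal n k Q c A b B d"
  shows "(nth_largest (score_vec n W) k - score_vec n W $ p > vUB - vLB \<longrightarrow> z $ p = 0) \<and>
         (score_vec n W $ p - nth_largest (score_vec n W) (k + 1) > vUB - vLB \<longrightarrow> z $ p = 1)"
proof -
  define w where "w = score_vec n W"
  define \<mu> where "\<mu> = W $$ (0, 0)"
  define T where "T = {i. i < n \<and> z $ i = 1}"
  have feas: "(x, z) \<in> miqp_feasible n k A b B d" using opt by (auto simp: miqp_optimal_def)
  have W: "W \<in> psd_mats (n + 1)" using dual by (auto simp: dual_feasible_def)
  have dim_w: "dim_vec w = n" by (simp add: w_def score_vec_def split_block_def Let_def)
  have w_le: "w $ i \<le> \<mu>" if "i < n" for i
    using score_vec_bounds(1)[OF W that] by (simp add: w_def \<mu>_def)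
  \<comment> \<open>The form at the first unit vector; \<open>k\<close> only ensures that 1 is a
    second valid index.\<close>
  have \<mu>: "0 \<le> \<mu>"
    using psd_mats_two_entries[OF W, of 0 1 1 0] k by (simp add: \<mu>_def)
  have w_ge: "0 \<le> w $ i" if "i < n" for i
    using score_vec_index[of W n i] W that by (simp add: w_def psd_mats_def sym_mats_def)
  have T: "finite T" "T \<subseteq> {..<n}" by (auto simp: T_def)
  have card_T: "card T \<le> k"
    and gap: "(real k - real (card T)) * \<mu> + (\<Sum>i\<in>T. \<mu> - w $ i) \<le> vUB - vLB"
    using gap_bound[OF Q c A b B d dual feas] miqp_optimal_le[OF opt vUB]
    unfolding T_def[symmetric] w_def \<mu>_def vLB by auto
  have sum_ge: "\<mu> - w $ i \<le> vUB - vLB" if "i \<in> T" for i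
  proof -
    have "\<mu> - w $ i \<le> (\<Sum>i\<in>T. \<mu> - w $ i)"
      using T w_le that by (intro member_le_sum) auto
    moreover have "0 \<le> (real k - real (card T)) * \<mu>" using card_T \<mu> by simp
    ultimately show ?thesis using gap by simp
  qed
  have "z $ p = 0" if less: "nth_largest w k - w $ p > vUB - vLB"
  proof (rule ccontr)
    assume "z $ p \<noteq> 0"
    then have "p \<in> T" using feas p by (auto simp: miqp_feasible_def T_def)
    \<comment> \<open>As an entry of \<open>w\<close>, the k-th largest score is at most \<mu>, so
      the summand of \<open>p\<close> already exceeds the allowed gap.\<close>
    moreover have "nth_largest w k \<le> \<mu>"
      using nth_largest_mem[of k w] k w_le dim_w by auto
    ultimately show False using sum_ge[of p] less by simp
  qed
  moreover have "z $ p = 1" if less: "w $ p - nth_largest w (k + 1) > vUB - vLB"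
  proof (rule ccontr)
    assume "z $ p \<noteq> 1"
    then have pT: "p \<notin> T" by (simp add: T_def)
    \<comment> \<open>The rank \<open>k + 1\<close> is valid because \<open>k < n\<close>.\<close>
    have nl: "0 \<le> nth_largest w (k + 1)"
      using nth_largest_mem[of "k + 1" w] k w_ge dim_w by auto
    have sum_nonneg: "0 \<le> (\<Sum>i\<in>T. \<mu> - w $ i)" using T w_le by (intro sum_nonneg) auto
    show False
    proof (cases "card T = k")
      case True
      \<comment> \<open>Adding \<open>p\<close> to \<open>T\<close> gives exactly
        \<open>k + 1\<close> indices.\<close>
      then have "\<exists>j \<in> insert p T. w $ j \<le> nth_largest w (k + 1)"
        using T pT p dim_w by (intro le_nth_largest_of_card) auto
      then obtain j where j: "j = p \<or> j \<in> T" "w $ j \<le> nth_largest w (k + 1)" by auto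
      \<comment> \<open>This excludes \<open>j = p\<close>: the score of \<open>p\<close> strictly
        exceeds the (k+1)-th largest.\<close>
      have "0 \<le> vUB - vLB" using gap sum_nonneg True by simp
      then have "j \<in> T" using j less by auto
      then show False using sum_ge[of j] j(2) w_le[OF p] less by simp
    next
      case False
      \<comment> \<open>At least one copy of \<mu> is unassigned, and \<mu> bounds
        \<open>w $ p\<close>, hence also \<open>w $ p - nth_largest w (k + 1)\<close>.\<close>
      then have "1 * \<mu> \<le> (real k - real (card T)) * \<mu>"
        using card_T \<mu> by (intro mult_right_mono) auto
      then show False using gap sum_nonneg nl w_le[OF p] less by simp
    qed
  qed
  ultimately show ?thesis by (simp add: w_def)
qed

end
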